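(* Let $w\in\mathfrak S_n$ and $\rho\in R(w)$. Then $\mathrm{inv}(\rho)=\ell(\mathrm{perm}(\rho))-\sum_{i=1}^{\ell(w)}(\pi_i-\rho_i)$ is a well-defined non-negative integer, where $\pi$ is the super-Yamanouchi reduced word for $w$. Moreover, there exists a sequence $f=f_{\mathrm{inv}(\rho)}\cdots f_1$ of Coxeter moves (each $f_j$ equal to some $\mathfrak c_i$ or $\mathfrak b_i$) such that $f(\rho)$ is super-Yamanouchi, and for any sequence $g=g_m\cdots g_1$ of Coxeter moves such that $g(\rho)$ is super-Yamanouchi, we have $m\ge \mathrm{inv}(\rho)$.
   Context: $s_i$ is the simple transposition of $\mathfrak S_n$; acting on a permutation in one-line notation it exchanges the entries in positions $i$ and $i+1$. $\ell(w)$ is the number of pairs $i<j$ with $w_i>w_j$. A reduced word for $w$ is a sequence $\rho=(\rho_\ell,\ldots,\rho_1)$, $\ell=\ell(w)$, indexed from right to left, with $w=s_{\rho_\ell}\cdots s_{\rho_1}\cdot\mathrm{id}$; $R(w)$ is the set of reduced words. The runs of $\rho$ are the maximal consecutive segments of $\rho$ that are strictly increasing read left to right, listed $(\rho^{(k)}\mid\cdots\mid\rho^{(1)})$ from left to right; $\rho$ is super-Yamanouchi if every run consists of consecutive integers and $\min(\rho^{(k)})>\cdots>\min(\rho^{(1)})$. Each $w$ has a unique super-Yamanouchi reduced word $\pi=(\pi_\ell,\ldots,\pi_1)$. Coxeter moves on $R(w)$: for $1\le i<\ell$, $\mathfrak c_i$ exchanges $\rho_i$ and $\rho_{i+1}$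 if $|\rho_i-\rho_{i+1}|>1$ and is the identity otherwise (commutation); for $1<i<\ell$, $\mathfrak b_i$ acts, when $\rho_{i-1}=\rho_{i+1}=a$ and $\rho_i=a\pm1$, by replacing the three letters in positions $i+1,i,i-1$, namely $a,a\pm1,a$, with $a\pm1,a,a\pm1$, and is the identity otherwise (Yang--Baxter move). The permutation $\mathrm{perm}(\rho)=v_1v_2\cdots v_\ell\in\mathfrak S_\ell$ (one-line notation) is computed as follows: initially all positions of $\rho$ are unpaired. For $i=\ell,\ell-1,\ldots,1$ in turn: set $k:=\pi_i$ and scan $j=\ell,\ell-1,\ldots,1$ in turn; if position $j$ is unpaired and $\rho_j=k$, pair position $j$ with $i$, set $v_i:=j$ and stop the scan; otherwise, if position $j$ is unpaired and $\rho_j=k-1$, replace $k$ by $k-1$ and continue scanning. $\ell(\mathrm{perm}(\rho))$ is the number of inversions of this permutation. *)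

theory Defs
  imports "HOL-Combinatorics.Permutations"
begin

text \<open>
  A permutation of \<open>{1..n}\<close> is a function \<open>w\<close> with \<open>w permutes {1..n}\<close>; its one-line
  notation is \<open>w 1, \<dots>, w n\<close>.
\<close>

definition perm_length :: "nat \<Rightarrow> (nat \<Rightarrow> nat) \<Rightarrow> nat" where
  "perm_length n w = card {(i, j). 1 \<le> i \<and> i < j \<and> j \<le> n \<and> w i > w j}"

text \<open>Composition on the right exchanges the entries in positions \<open>i\<close> and \<open>i + 1\<close>.\<close>

definition simple_act :: "nat \<Rightarrow> (nat \<Rightarrow> nat) \<Rightarrow> (nat \<Rightarrow> nat)" where
  "simple_act i w = w \<circ> transpose i (i + 1)"

text \<open>
  A word \<open>(\<rho>\<^sub>\<ell>, \<dots>, \<rho>\<^sub>1)\<close> is the list \<open>[\<rho>\<^sub>\<ell>, \<dots>, \<rho>\<^sub>1]\<close>, so the letter \<open>\<rho>\<^sub>i\<close>, for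
  \<open>1 \<le> i \<le> \<ell>\<close>, sits at list index \<open>\<ell> - i\<close>.
\<close>

definition letter :: "nat list \<Rightarrow> nat \<Rightarrow> nat" where
  "letter \<rho> i = \<rho> ! (length \<rho> - i)"

definition set_letter :: "nat \<Rightarrow> nat \<Rightarrow> nat list \<Rightarrow> nat list" where
  "set_letter i a \<rho> = \<rho>[length \<rho> - i := a]"

definition word_perm :: "nat list \<Rightarrow> (nat \<Rightarrow> nat)" where
  "word_perm \<rho> = foldr simple_act \<rho> id"

definition reduced_words :: "nat \<Rightarrow> (nat \<Rightarrow> nat) \<Rightarrow> nat list set" where
  "reduced_words n w = {\<rho>. set \<rho> \<subseteq> {1..<n} \<and> length \<rho> = perm_length n w \<and> w = word_perm \<rho>}"

text \<open>The maximal strictly increasing segments, from left to right.\<close>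

fun runs :: "nat list \<Rightarrow> nat list list" where
  "runs [] = []"
| "runs [a] = [[a]]"
| "runs (a # b # \<rho>) =
     (if a < b then (a # hd (runs (b # \<rho>))) # tl (runs (b # \<rho>)) else [a] # runs (b # \<rho>))"

definition super_yamanouchi :: "nat list \<Rightarrow> bool" where
  "super_yamanouchi \<rho> \<longleftrightarrow>
     (\<forall>r \<in> set (runs \<rho>). \<exists>a b. r = [a..<b]) \<and>
     sorted_wrt (>) (map (\<lambda>r. Min (set r)) (runs \<rho>))"

definition super_yamanouchi_word :: "nat \<Rightarrow> (nat \<Rightarrow> nat) \<Rightarrow> nat list" where
  "super_yamanouchi_word n w = (THE \<pi>. \<pi> \<in> reduced_words n w \<and> super_yamanouchi \<pi>)"

definition commutation_move :: "nat \<Rightarrow> nat list \<Rightarrow> nat list" where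
  "commutation_move i \<rho> =
     (if \<bar>int (letter \<rho> i) - int (letter \<rho> (i + 1))\<bar> > 1
      then set_letter i (letter \<rho> (i + 1)) (set_letter (i + 1) (letter \<rho> i) \<rho>)
      else \<rho>)"

definition yang_baxter_move :: "nat \<Rightarrow> nat list \<Rightarrow> nat list" where
  "yang_baxter_move i \<rho> =
     (let a = letter \<rho> (i + 1); b = letter \<rho> i in
      if letter \<rho> (i - 1) = a \<and> (b = a + 1 \<or> a = b + 1)
      then set_letter (i + 1) b (set_letter i a (set_letter (i - 1) b \<rho>))
      else \<rho>)"

definition coxeter_moves :: "nat \<Rightarrow> (nat list \<Rightarrow> nat list) set" where
  "coxeter_moves l =
     {commutation_move i | i. 1 \<le> i \<and> i < l} \<union> {yang_baxter_move i | i. 1 < i \<and> i < l}"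

text \<open>A sequence \<open>f\<^sub>m \<cdots> f\<^sub>1\<close> is the list \<open>[f\<^sub>m, \<dots>, f\<^sub>1]\<close>; \<open>f\<^sub>1\<close> is applied first.\<close>

definition apply_moves :: "(nat list \<Rightarrow> nat list) list \<Rightarrow> nat list \<Rightarrow> nat list" where
  "apply_moves fs \<rho> = foldr (\<lambda>f. f) fs \<rho>"

text \<open>
  \<open>scan \<rho> P k j\<close> scans the positions \<open>j, j - 1, \<dots>, 1\<close> of \<open>\<rho>\<close> for the value \<open>k\<close>, where \<open>P\<close> is
  the set of positions already paired; \<open>None\<close> means that the scan ends without a pairing.
\<close>

fun scan :: "nat list \<Rightarrow> nat set \<Rightarrow> nat \<Rightarrow> nat \<Rightarrow> nat option" where
  "scan \<rho> P k 0 = None"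
| "scan \<rho> P k (Suc j) =
     (if Suc j \<notin> P \<and> letter \<rho> (Suc j) = k then Some (Suc j)
      else if Suc j \<notin> P \<and> letter \<rho> (Suc j) + 1 = k then scan \<rho> P (k - 1) j
      else scan \<rho> P k j)"

text \<open>
  \<open>pair_from \<pi> \<rho> v i\<close> performs the steps \<open>i, i - 1, \<dots>, 1\<close>, starting from the partial
  assignment \<open>v\<close>; the paired positions are the values of \<open>v\<close>.
\<close>

fun pair_from :: "nat list \<Rightarrow> nat list \<Rightarrow> (nat \<Rightarrow> nat option) \<Rightarrow> nat \<Rightarrow> (nat \<Rightarrow> nat option)" where
  "pair_from \<pi> \<rho> v 0 = v"
| "pair_from \<pi> \<rho> v (Suc i) =
     pair_from \<pi> \<rho> (v(Suc i := scan \<rho> (ran v) (letter \<pi> (Suc i)) (length \<rho>))) i"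

definition pairing :: "nat \<Rightarrow> (nat \<Rightarrow> nat) \<Rightarrow> nat list \<Rightarrow> (nat \<Rightarrow> nat option)" where
  "pairing n w \<rho> = pair_from (super_yamanouchi_word n w) \<rho> Map.empty (perm_length n w)"

text \<open>Indices outside \<open>{1..\<ell>}\<close> are fixed, as \<open>permutes\<close> requires.\<close>

definition perm_word :: "nat \<Rightarrow> (nat \<Rightarrow> nat) \<Rightarrow> nat list \<Rightarrow> (nat \<Rightarrow> nat)" where
  "perm_word n w \<rho> i = (case pairing n w \<rho> i of Some j \<Rightarrow> j | None \<Rightarrow> i)"

definition inv_word :: "nat \<Rightarrow> (nat \<Rightarrow> nat) \<Rightarrow> nat list \<Rightarrow> int" where
  "inv_word n w \<rho> =
     int (perm_length (perm_length n w) (perm_word n w \<rho>)) -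
     (\<Sum>i = 1..perm_length n w. int (letter (super_yamanouchi_word n w) i) - int (letter \<rho> i))"

end

theory Submission
  imports Defs
begin

text \<open>
  To every letter of a reduced word attach a key: the final position of the larger of the two
  strands crossing there. A commutation move exchanges two distinct adjacent keys, and a
  Yang--Baxter move exchanges \<open>(\<alpha>, \<alpha>, \<beta>)\<close> and \<open>(\<beta>, \<alpha>, \<alpha>)\<close>, \<open>\<alpha> < \<beta>\<close>, while
  changing the sum of the letters by one. Hence the number of increasing pairs of keys plus the
  sum of the letters (the rank) changes by exactly one under every effective move, and a word
  without a rank-decreasing move is super-Yamanouchi. On the other hand, the first step of the
  pairing picks the leftmost letter of maximal key, the position of the last descent of \<open>w\<close>, and
  deleting it leaves a reduced word whose keys have the same relative order; so
  \<open>perm(\<rho>)\<close> has as many inversions as there are increasing pairs of keys, and \<open>inv(\<rho>)\<close> is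
  the difference of the ranks of \<open>\<rho>\<close> and \<open>\<pi>\<close>.
\<close>

subsection \<open>Reduced words\<close>

lemma word_perm_Nil [simp]: "word_perm [] = id"
  by (simp add: word_perm_def)

lemma word_perm_Cons: "word_perm (c # \<rho>) = word_perm \<rho> \<circ> transpose c (Suc c)"
  by (simp add: word_perm_def simple_act_def)

lemma word_perm_Cons_apply [simp]: "word_perm (c # \<rho>) x = word_perm \<rho> (transpose c (Suc c) x)"
  by (simp add: word_perm_Cons)

lemma word_perm_append: "word_perm (p @ s) = word_perm s \<circ> word_perm p"
  by (induction p) (auto simp: fun_eq_iff)

lemma bij_word_perm: "bij (word_perm \<rho>)"
  by (induction \<rho>) (simp_all only: word_perm_Nil word_perm_Cons bij_id bij_comp bij_transpose)

lemma word_perm_eq_iff [simp]: "word_perm \<rho> a = word_perm \<rho> b \<longleftrightarrow> a = b"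
  using bij_word_perm[of \<rho>] by (auto dest: bij_is_inj injD)

text \<open>Reducedness tested letter by letter: read from right to left, every letter meets an
  ascent and so creates an inversion.\<close>

fun red :: "nat list \<Rightarrow> bool" where
  "red [] \<longleftrightarrow> True"
| "red (c # \<rho>) \<longleftrightarrow> red \<rho> \<and> word_perm \<rho> c < word_perm \<rho> (Suc c)"

lemma perm_length_transpose_ascent:
  assumes c: "1 \<le> c" "c < n" and asc: "w c < w (Suc c)"
  shows "perm_length n (w \<circ> transpose c (Suc c)) = Suc (perm_length n w)"
proof -
  let ?t = "transpose c (Suc c)"
  let ?f = "\<lambda>(i, j). (?t i, ?t j)"
  let ?I = "\<lambda>w. {(i, j). 1 \<le> i \<and> i < j \<and> j \<le> n \<and> w i > (w j :: nat)}"
  have fin: "finite (?I w)"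
    by (rule finite_subset[of _ "{..n} \<times> {..n}"]) auto
  have lt: "?t i < ?t j" if "i < j" "(i, j) \<noteq> (c, Suc c)" for i j
    using that by (auto simp: transpose_def)
  have rng: "1 \<le> ?t i \<and> ?t i \<le> n \<longleftrightarrow> 1 \<le> i \<and> i \<le> n" for i
    using c by (auto simp: transpose_def)
  \<comment> \<open>Apart from \<open>(c, Suc c)\<close>, \<open>?t\<close> keeps the order of every
    pair, so it carries the inversions of \<open>w\<close> to the new ones other than that
    pair.\<close>
  have "?I (w \<circ> ?t) = insert (c, Suc c) (?f ` ?I w)"
  proof (intro set_eqI iffI)
    fix x assume x: "x \<in> ?I (w \<circ> ?t)"
    obtain i j where ij: "x = (i, j)" by force
    show "x \<in> insert (c, Suc c) (?f ` ?I w)"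
    proof (cases "(i, j) = (c, Suc c)")
      case False
      have "(?t i, ?t j) \<in> ?I w"
        using x ij lt[OF _ False] rng[of i] rng[of j] by auto
      moreover have "x = ?f (?t i, ?t j)" by (simp add: ij)
      ultimately show ?thesis by blast
    qed (simp add: ij)
  next
    fix x assume "x \<in> insert (c, Suc c) (?f ` ?I w)"
    then consider "x = (c, Suc c)" | i j where "x = (?t i, ?t j)" "(i, j) \<in> ?I w" by auto
    then show "x \<in> ?I (w \<circ> ?t)"
    proof cases
      case 1
      then show ?thesis using c asc by simp
    next
      case 2
      then have "(i, j) \<noteq> (c, Suc c)" using asc by auto
      then show ?thesis using 2 lt[of i j] rng[of i] rng[of j] by auto
    qed
  qed
  moreover have "(c, Suc c) \<notin> ?f ` ?I w"
  proof
    assume "(c, Suc c) \<in> ?f ` ?I w"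
    then obtain i j where "c = ?t i" "Suc c = ?t j" "i < j" by auto
    then show False by (auto simp: transpose_def split: if_splits)
  qed
  moreover have "card (?f ` ?I w) = card (?I w)"
    by (rule card_image) (auto simp: inj_on_def dest: injD[OF inj_transpose])
  ultimately show ?thesis
    using fin by (simp add: perm_length_def)
qed

lemma perm_length_transpose_descent:
  assumes "1 \<le> c" "c < n" and "w (Suc c) < w c"
  shows "Suc (perm_length n (w \<circ> transpose c (Suc c))) = perm_length n w"
  using perm_length_transpose_ascent[of c n "w \<circ> transpose c (Suc c)"] assms
  by (simp add: comp_assoc)

text \<open>Each letter changes the length by one, up or down. The bound serves the induction: after
  a descent the length can no longer catch up with the number of letters.\<close>

lemma perm_length_word_perm:
  assumes "set \<rho> \<subseteq> {1..<n}"
  shows "perm_length n (word_perm \<rho>) \<le> length \<rho> \<and>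
    (red \<rho> \<longleftrightarrow> perm_length n (word_perm \<rho>) = length \<rho>)"
  using assms
proof (induction \<rho>)
  case Nil
  have "{(i, j). 1 \<le> i \<and> i < j \<and> j \<le> n \<and> id i > id j} = ({} :: (nat \<times> nat) set)" by auto
  then show ?case by (simp only: perm_length_def word_perm_Nil) simp
next
  case (Cons c \<rho>)
  then have IH: "perm_length n (word_perm \<rho>) \<le> length \<rho>"
    "red \<rho> \<longleftrightarrow> perm_length n (word_perm \<rho>) = length \<rho>" and c: "1 \<le> c" "c < n"
    by auto
  show ?case
  proof (cases "word_perm \<rho> c < word_perm \<rho> (Suc c)")
    case True
    have "perm_length n (word_perm (c # \<rho>)) = Suc (perm_length n (word_perm \<rho>))"
      unfolding word_perm_Cons by (rule perm_length_transpose_ascent[OF c True])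
    then show ?thesis
      using IH True by (simp del: word_perm_Cons_apply)
  next
    case False
    then have "word_perm \<rho> (Suc c) < word_perm \<rho> c"
      using word_perm_eq_iff[of \<rho> c "Suc c"] by linarith
    then have "Suc (perm_length n (word_perm (c # \<rho>))) = perm_length n (word_perm \<rho>)"
      unfolding word_perm_Cons by (rule perm_length_transpose_descent[OF c])
    then show ?thesis
      using IH False by (simp del: word_perm_Cons_apply)
  qed
qed

lemma reduced_words_iff:
  "\<rho> \<in> reduced_words n w \<longleftrightarrow> set \<rho> \<subseteq> {1..<n} \<and> red \<rho> \<and> w = word_perm \<rho>"
  using perm_length_word_perm[of \<rho> n] by (auto simp: reduced_words_def)

lemma red_imp_distinct_adj: "red \<rho> \<Longrightarrow> distinct_adj \<rho>"
proof (induction \<rho> rule: induct_list012)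
  case (3 x y zs)
  then show ?case by (cases "x = y") auto
qed auto

lemma red_appendD: "red (p @ s) \<Longrightarrow> red s"
  by (induction p) auto

lemma red_descent: "red (c # \<rho>) \<Longrightarrow> word_perm (c # \<rho>) (Suc c) < word_perm (c # \<rho>) c"
  by simp

lemma red_word_perm_id: "red \<rho> \<Longrightarrow> word_perm \<rho> = id \<Longrightarrow> \<rho> = []"
  by (metis Suc_n_not_le_n id_apply less_imp_le list.exhaust red_descent)

subsection \<open>Traces and keys\<close>

text \<open>
  Read as a wiring diagram, the strand at position \<open>x\<close> to the right of the prefix \<open>p\<close> ends at
  position \<open>trace p x\<close>.
\<close>

fun trace :: "nat list \<Rightarrow> nat \<Rightarrow> nat" where
  "trace [] x = x"
| "trace (c # p) x = transpose c (Suc c) (trace p x)"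

text \<open>In \<open>p @ c # s\<close> the letter \<open>c\<close> receives
  \<open>trace p c\<close>, since in a reduced word the larger strand leaves that crossing at
  position \<open>c\<close>. The recursion carries the keys of \<rho> through the crossing put in
  front.\<close>

fun keys :: "nat list \<Rightarrow> nat list" where
  "keys [] = []"
| "keys (c # \<rho>) = c # map (transpose c (Suc c)) (keys \<rho>)"

lemma trace_append [simp]: "trace (p @ s) x = trace p (trace s x)"
  by (induction p) auto

lemma keys_append: "keys (p @ s) = keys p @ map (trace p) (keys s)"
  by (induction p) auto

lemma length_keys [simp]: "length (keys \<rho>) = length \<rho>"
  by (induction \<rho>) auto

lemma word_perm_trace [simp]: "word_perm (p @ s) (trace p x) = word_perm s x"
  by (induction p) auto

lemma word_perm_prefix_trace [simp]: "word_perm p (trace p x) = x"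
  using word_perm_trace[of p "[]"] by simp

lemma trace_word_perm [simp]: "trace p (word_perm p x) = x"
  by (metis word_perm_eq_iff word_perm_prefix_trace)

lemma trace_eq_iff [simp]: "trace p a = trace p b \<longleftrightarrow> a = b"
  by (metis word_perm_prefix_trace)

lemma trace_ge: "\<forall>c \<in> set p. i \<le> c \<Longrightarrow> i \<le> x \<Longrightarrow> i \<le> trace p x"
  by (induction p) (auto simp: transpose_def)

lemma trace_below: "\<forall>c \<in> set p. x < c \<Longrightarrow> trace p x = x"
  by (induction p) (auto simp: transpose_def)

lemma trace_upt: "i \<le> b \<Longrightarrow> trace [i..<b] b = i"
  by (induction b rule: dec_induct) auto

lemma trace_transpose:
  "trace p (transpose a b x) = transpose (trace p a) (trace p b) (trace p x)"
  by (auto simp: transpose_def)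

text \<open>Two strands cross at most once, and only in the direction that creates an inversion.\<close>

lemma red_noncrossing:
  assumes "red (p @ s)" "a < b" "trace p b < trace p a"
  shows "word_perm s a < word_perm s b"
  using assms
proof (induction p)
  case (Cons c p)
  show ?case
  proof (cases "trace p b < trace p a")
    case False
    then have "trace p a < trace p b"
      using Cons.prems(2) trace_eq_iff[of p a b] by linarith
    \<comment> \<open>The order flips at the letter \<open>c\<close>, so the two strands are the
      ones crossing there.\<close>
    then have "trace p a = c" "trace p b = Suc c"
      using Cons.prems(3) by (auto simp: transpose_def split: if_splits)
    then show ?thesis
      using Cons.prems(1) by (metis append_Cons red.simps(2) word_perm_trace)
  qed (use Cons in auto)
qed simp

text \<open>The strands at \<open>c\<close> and \<open>Suc c\<close> have just crossed. If
  \<open>p\<close> reversed them again, \<open>red_noncrossing\<close> would require an ascent where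
  \<open>c\<close> has created a descent.\<close>

lemma trace_descent_less:
  assumes "red (p @ c # s)"
  shows "trace p c < trace p (Suc c)"
proof (rule ccontr)
  assume "\<not> ?thesis"
  then have "trace p (Suc c) < trace p c"
    using trace_eq_iff[of p c "Suc c"] by linarith
  then show False
    using red_noncrossing[OF assms, of c "Suc c"] red_appendD[OF assms] by simp
qed

text \<open>The two strands crossing at \<open>c\<close> form an inversion of the whole permutation,
  with left member at \<open>trace p c\<close>; no inversion lies entirely beyond
  \<open>i\<close>.\<close>

lemma trace_le_last_descent:
  assumes red: "red (p @ c # s)" and mono: "strict_mono_on {i<..} (word_perm (p @ c # s))"
  shows "trace p c \<le> i"
proof (rule ccontr)
  assume "\<not> ?thesis"
  then have "word_perm (p @ c # s) (trace p c) < word_perm (p @ c # s) (trace p (Suc c))"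
    using trace_descent_less[OF red] by (intro strict_mono_onD[OF mono]) auto
  then have "word_perm (c # s) c < word_perm (c # s) (Suc c)"
    by (simp only: word_perm_trace)
  with red_descent[OF red_appendD[OF red]] show False by simp
qed

lemma in_set_keysD:
  "x \<in> set (keys \<rho>) \<Longrightarrow> \<exists>p c s. \<rho> = p @ c # s \<and> x = trace p c"
proof (induction \<rho> arbitrary: x)
  case (Cons d \<rho>)
  consider "x = d" | y where "y \<in> set (keys \<rho>)" "x = transpose d (Suc d) y"
    using Cons.prems by auto
  then show ?case
  proof cases
    case 1
    then have "d # \<rho> = [] @ d # \<rho> \<and> x = trace [] d" by simp
    then show ?thesis by blast
  next
    case 2
    with Cons.IH obtain p c s where "\<rho> = p @ c # s" "y = trace p c" by blast
    with 2 have "d # \<rho> = (d # p) @ c # s \<and> x = trace (d # p) c" by simp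
    then show ?thesis by blast
  qed
qed simp

lemma keys_le_last_descent:
  assumes "red \<rho>" "strict_mono_on {i<..} (word_perm \<rho>)" "x \<in> set (keys \<rho>)"
  shows "x \<le> i"
proof -
  obtain p c s where "\<rho> = p @ c # s" "x = trace p c"
    using in_set_keysD[OF assms(3)] by blast
  then show ?thesis using trace_le_last_descent assms by blast
qed

subsection \<open>The rank of a word\<close>

text \<open>Since \<open>letter\<close> numbers a list from right to left, these pairs are the
  inversions in that numbering.\<close>

fun asc_pairs :: "nat list \<Rightarrow> nat" where
  "asc_pairs [] = 0"
| "asc_pairs (x # xs) = length (filter (\<lambda>y. x < y) xs) + asc_pairs xs"

lemma asc_pairs_append:
  "asc_pairs (xs @ ys) = asc_pairs xs + asc_pairs ys + (\<Sum>x\<leftarrow>xs. length (filter (\<lambda>y. x < y) ys))"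
  by (induction xs) auto

lemma asc_pairs_map:
  "strict_mono_on (set xs) h \<Longrightarrow> asc_pairs (map h xs) = asc_pairs xs"
proof (induction xs)
  case (Cons x xs)
  have "strict_mono_on (set xs) h"
    using Cons.prems by (rule monotone_on_subset) auto
  moreover have "filter (\<lambda>y. h x < h y) xs = filter (\<lambda>y. x < y) xs"
    using strict_mono_on_less[OF Cons.prems] by (intro filter_cong) auto
  ultimately show ?case
    using Cons.IH by (simp add: filter_map comp_def)
qed simp

lemma asc_pairs_sorted: "sorted_wrt (\<ge>) xs \<Longrightarrow> asc_pairs xs = 0"
  by (induction xs) (auto simp: filter_empty_conv not_less)

definition rank :: "nat list \<Rightarrow> nat" where
  "rank \<rho> = asc_pairs (keys \<rho>) + sum_list \<rho>"

text \<open>The effective Coxeter moves, directed so that the rank falls by one on reduced words. A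
  braid loses two increasing pairs of keys and raises the letter sum by one.\<close>

inductive down :: "nat list \<Rightarrow> nat list \<Rightarrow> bool" where
  commute: "Suc c < d \<or> Suc d < c \<Longrightarrow> trace p c < trace p d \<Longrightarrow>
    down (p @ [c, d] @ s) (p @ [d, c] @ s)"
| braid: "down (p @ [a, Suc a, a] @ s) (p @ [Suc a, a, Suc a] @ s)"

lemma down_append: "down \<rho> \<rho>' \<Longrightarrow> down (\<rho> @ t) (\<rho>' @ t)"
proof (induction rule: down.induct)
  case (commute c d p s)
  then show ?case using down.commute[of c d p "s @ t"] by simp
next
  case (braid p a s)
  then show ?case using down.braid[of p a "s @ t"] by simp
qed

lemma transpose_commute:
  "Suc c < d \<or> Suc d < c \<Longrightarrow>
    transpose c (Suc c) (transpose d (Suc d) x) = transpose d (Suc d) (transpose c (Suc c) x)"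
  by (auto simp: transpose_def)

lemma transpose_braid:
  "transpose a (Suc a) (transpose (Suc a) (Suc (Suc a)) (transpose a (Suc a) x)) =
    transpose (Suc a) (Suc (Suc a)) (transpose a (Suc a) (transpose (Suc a) (Suc (Suc a)) x))"
  by (auto simp: transpose_def)

lemma down_length: "down \<rho> \<rho>' \<Longrightarrow> length \<rho>' = length \<rho>"
  by (induction rule: down.induct) auto

lemma down_set: "down \<rho> \<rho>' \<Longrightarrow> set \<rho>' = set \<rho>"
  by (induction rule: down.induct) auto

lemma down_word_perm: "down \<rho> \<rho>' \<Longrightarrow> word_perm \<rho>' = word_perm \<rho>"
proof (induction rule: down.induct)
  case (commute c d p s)
  then show ?case
    by (auto simp: word_perm_append fun_eq_iff transpose_commute)
next
  case (braid p a s)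
  then show ?case
    by (auto simp: word_perm_append fun_eq_iff transpose_braid)
qed

lemma down_reduced_words: "down \<rho> \<rho>' \<Longrightarrow> \<rho>' \<in> reduced_words n w \<longleftrightarrow> \<rho> \<in> reduced_words n w"
  by (simp add: reduced_words_def down_length down_set down_word_perm)

text \<open>Pairs with a member outside the block see only its multiset. The additive form avoids
  subtraction on naturals.\<close>

lemma asc_pairs_block:
  assumes "mset bs = mset bs'"
  shows "asc_pairs (xs @ bs @ ys) + asc_pairs bs' = asc_pairs (xs @ bs' @ ys) + asc_pairs bs"
proof -
  have "length (filter P bs) = length (filter P bs')" for P
    using assms by (metis mset_filter size_mset)
  moreover have "(\<Sum>x\<leftarrow>bs. f x) = (\<Sum>x\<leftarrow>bs'. f x)" for f :: "nat \<Rightarrow> nat"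
    using assms by (metis mset_map sum_mset_sum_list)
  ultimately show ?thesis by (simp add: asc_pairs_append)
qed

lemma down_rank:
  assumes "down \<rho> \<rho>'" "red \<rho>"
  shows "rank \<rho> = Suc (rank \<rho>')"
  using assms
proof (induction rule: down.induct)
  case (commute c d p s)
  define ys where "ys = map (trace (p @ [c, d])) (keys s)"
  \<comment> \<open>Both orders of the letters move strands alike, so the keys of \<open>s\<close>
    are the same before and after.\<close>
  have "trace (p @ [d, c]) = trace (p @ [c, d])"
    using transpose_commute[OF commute(1)] by (auto simp: fun_eq_iff)
  moreover have "transpose c (Suc c) d = d" "transpose d (Suc d) c = c"
    using commute(1) by (auto simp: transpose_def)
  ultimately have "keys (p @ [c, d] @ s) = keys p @ [trace p c, trace p d] @ ys"
    "keys (p @ [d, c] @ s) = keys p @ [trace p d, trace p c] @ ys"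
    by (auto simp: keys_append ys_def fun_eq_iff)
  then show ?case
    using asc_pairs_block[of "[trace p c, trace p d]" "[trace p d, trace p c]" "keys p" ys]
      commute(2) by (simp add: rank_def)
next
  case (braid p a s)
  define ys where "ys = map (trace (p @ [a, Suc a, a])) (keys s)"
  have less: "trace p a < trace p (Suc a)"
    using trace_descent_less[of p a "[Suc a, a] @ s"] braid by simp
  have "trace (p @ [Suc a, a, Suc a]) = trace (p @ [a, Suc a, a])"
    by (simp add: fun_eq_iff transpose_braid)
  then have "keys (p @ [a, Suc a, a] @ s) = keys p @ [trace p a, trace p a, trace p (Suc a)] @ ys"
    "keys (p @ [Suc a, a, Suc a] @ s) = keys p @ [trace p (Suc a), trace p a, trace p a] @ ys"
    by (auto simp: keys_append ys_def fun_eq_iff transpose_def)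
  then show ?case
    using asc_pairs_block[of "[trace p a, trace p a, trace p (Suc a)]"
        "[trace p (Suc a), trace p a, trace p a]" "keys p" ys] less
    by (simp add: rank_def)
qed

subsection \<open>Super-Yamanouchi words\<close>

text \<open>Here \<open>canon i \<pi>\<close> means that \<open>\<pi>\<close> is super-Yamanouchi with all run minima at least \<open>i\<close>.\<close>

inductive canon :: "nat \<Rightarrow> nat list \<Rightarrow> bool" where
  Nil: "canon i []"
| snoc: "canon j \<pi> \<Longrightarrow> i < j \<Longrightarrow> i < b \<Longrightarrow> h \<le> i \<Longrightarrow> canon h (\<pi> @ [i..<b])"

lemma canon_mono: "canon i \<pi> \<Longrightarrow> h \<le> i \<Longrightarrow> canon h \<pi>"
  by (erule canon.cases) (auto intro: canon.intros)

lemma canon_ge: "canon i \<pi> \<Longrightarrow> c \<in> set \<pi> \<Longrightarrow> i \<le> c"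
  by (induction rule: canon.induct) fastforce+

lemma canon_upt: "canon i [i..<b]"
  using canon.snoc[OF canon.Nil, of i "Suc i" b i] by (cases "i < b") (auto intro: canon.Nil)

text \<open>Shortening the first run raises or removes the largest run minimum, so the minima still
  decrease. Uniqueness and the pairing both peel words from the left.\<close>

lemma canon_ConsD: "canon i (c # \<pi>) \<Longrightarrow> canon i \<pi>"
proof (induction i "c # \<pi>" arbitrary: c \<pi> rule: canon.induct)
  case (snoc j \<pi>' i b h)
  show ?case
  proof (cases \<pi>')
    case Nil
    then have "\<pi> = [Suc i..<b]"
      using snoc.hyps by (metis append_Nil list.inject upt_conv_Cons)
    then show ?thesis
      using canon_mono[OF canon_upt] snoc.hyps by simp
  next
    case (Cons d \<pi>1)
    then show ?thesis
      using snoc.hyps canon.snoc[of j \<pi>1 i b h] by auto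
  qed
qed

lemma word_perm_upt:
  "i \<le> b \<Longrightarrow> word_perm [i..<b] x = (if x = i then b else if i < x \<and> x \<le> b then x - 1 else x)"
proof (induction b rule: dec_induct)
  case (step m)
  then show ?case
    by (auto simp: word_perm_append transpose_def)
qed auto

lemma word_perm_greater:
  assumes "\<forall>c \<in> set \<pi>. i < c" "i < x"
  shows "i < word_perm \<pi> x"
  using assms by (induction \<pi> arbitrary: x) (auto simp: transpose_def)

text \<open>For a reduced word this makes the first letter the last descent. The earlier runs have
  letters above \<open>i\<close> and preserve \<open>{i<..}\<close>, on which the cycle given by the
  last run \<open>[i..<b]\<close> is increasing.\<close>

lemma canon_strict_mono:
  "canon i (c # \<pi>) \<Longrightarrow> strict_mono_on {c<..} (word_perm (c # \<pi>))"
proof (induction i "c # \<pi>" arbitrary: c \<pi> rule: canon.induct)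
  case (snoc j \<pi>' i b h)
  have upt: "word_perm [i..<b] x < word_perm [i..<b] y" if "i < x" "x < y" for x y
    using that snoc.hyps by (auto simp: word_perm_upt)
  show ?case
  proof (cases \<pi>')
    case Nil
    then have "c # \<pi> = [i..<b]" "c = i"
      using snoc.hyps by (auto simp: upt_conv_Cons)
    then show ?thesis
      using upt by (intro strict_mono_onI) auto
  next
    case (Cons d \<pi>1)
    have gt: "\<forall>e \<in> set \<pi>'. i < e"
      using canon_ge[OF snoc.hyps(1)] snoc.hyps(3) by fastforce
    have c: "c = d" "c # \<pi> = \<pi>' @ [i..<b]" using Cons snoc.hyps by auto
    have "i < c" using gt Cons c by simp
    have "strict_mono_on {c<..} (word_perm \<pi>')"
      using snoc.hyps(2) Cons c by simp
    then show ?thesis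
      unfolding c(2) word_perm_append
      using upt word_perm_greater[OF gt] \<open>i < c\<close>
      by (auto simp: strict_mono_on_def)
  qed
qed

text \<open>In a run all letters have the run's minimum as key, and the preceding runs, whose
  letters are larger, do not move it. Hence there are no increasing pairs of keys.\<close>

lemma canon_keys: "canon i \<pi> \<Longrightarrow> sorted_wrt (\<ge>) (keys \<pi>) \<and> (\<forall>x \<in> set (keys \<pi>). i \<le> x)"
proof (induction rule: canon.induct)
  case (snoc j \<pi> i b h)
  have gt: "\<forall>e \<in> set \<pi>. i < e"
    using canon_ge[OF snoc.hyps(1)] snoc.hyps(2) by fastforce
  have "keys [i..<b] = replicate (b - i) i" if "i \<le> b" for b
    using that
  proof (induction b rule: dec_induct)
    case (step m)
    then show ?case
      by (simp add: keys_append trace_upt Suc_diff_le replicate_append_same)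
  qed simp
  then have "keys (\<pi> @ [i..<b]) = keys \<pi> @ replicate (b - i) i"
    using snoc.hyps trace_below[OF gt] by (simp add: keys_append)
  moreover have "sorted_wrt (\<ge>) (replicate m i)" for m
    by (induction m) auto
  moreover have "i \<le> x" if "x \<in> set (keys \<pi>)" for x
    using snoc.IH snoc.hyps(2) that by fastforce
  ultimately show ?case
    using snoc.IH snoc.hyps(4) by (auto simp: sorted_wrt_append intro: order_trans)
qed simp

text \<open>The first letter is the last descent of the permutation, hence determined by it; cancel
  it and induct.\<close>

lemma canon_unique:
  assumes "canon i \<pi>" "canon j \<pi>'" "red \<pi>" "red \<pi>'" "word_perm \<pi> = word_perm \<pi>'"
  shows "\<pi> = \<pi>'"
  using assms
proof (induction \<pi> arbitrary: \<pi>' rule: list.induct)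
  case Nil
  then show ?case by (metis red_word_perm_id word_perm_Nil)
next
  case (Cons c \<pi>)
  then obtain d \<sigma> where \<pi>': "\<pi>' = d # \<sigma>"
    by (metis red_word_perm_id word_perm_Nil neq_Nil_conv)
  have "\<not> c < d"
    using strict_mono_onD[OF canon_strict_mono[OF Cons.prems(1)], of d "Suc d"]
      red_descent[of d \<sigma>] Cons.prems(4,5) \<pi>' by auto
  moreover have "\<not> d < c"
    using strict_mono_onD[OF canon_strict_mono, of j d \<sigma> c "Suc c"]
      red_descent[OF Cons.prems(3)] Cons.prems(2,5) \<pi>' by auto
  ultimately have "c = d" by simp
  have "(word_perm \<pi> \<circ> transpose c (Suc c)) \<circ> transpose c (Suc c) =
      (word_perm \<sigma> \<circ> transpose c (Suc c)) \<circ> transpose c (Suc c)"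
    using Cons.prems(5) unfolding \<pi>' \<open>c = d\<close> word_perm_Cons by (rule arg_cong)
  then have "word_perm \<pi> = word_perm \<sigma>" by (simp add: comp_assoc)
  then show ?case
    using Cons.IH[of \<sigma>] Cons.prems \<pi>' \<open>c = d\<close> canon_ConsD by auto
qed

text \<open>Append letters on the right. Compared with the last run \<open>[l..<b]\<close>, the new
  letter \<open>a\<close> starts a run (\<open>a < l\<close>), extends the run
  (\<open>a = b\<close>), completes a braid (\<open>Suc a = b - 1\<close>) or commutes past
  \<open>b - 1\<close>; \<open>a = b - 1\<close> is excluded.\<close>

lemma down_or_canon:
  "distinct_adj \<rho> \<Longrightarrow> (\<exists>i. canon i \<rho>) \<or> (\<exists>\<rho>'. down \<rho> \<rho>')"
proof (induction \<rho> rule: rev_induct)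
  case (snoc a \<rho>)
  then consider \<rho>' where "down \<rho> \<rho>'" | i where "canon i \<rho>"
    by (auto simp: distinct_adj_append_iff)
  then show ?case
  proof cases
    case 1
    then show ?thesis using down_append by blast
  next
    case 2
    then show ?thesis
    proof cases
      case Nil
      then show ?thesis using canon_upt[of a "Suc a"] by auto
    next
      case (snoc j \<pi> l b)
      have ne: "a \<noteq> b - 1"
        using \<open>distinct_adj (\<rho> @ [a])\<close> snoc by (auto simp: distinct_adj_append_iff)
      define p where "p = \<pi> @ [l..<b - 1]"
      have \<rho>: "\<rho> = p @ [b - 1]"
        using snoc upt_Suc_append[of l "b - 1"] by (simp add: p_def)
      have gt: "\<forall>e \<in> set \<pi>. l < e"
        using canon_ge[OF snoc(2)] snoc(3) by fastforce
      have tr: "trace p (b - 1) = l"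
        using snoc trace_below[OF gt] by (simp add: p_def trace_upt)
      have "\<forall>e \<in> set p. l \<le> e" using gt by (auto simp: p_def)
      \<comment> \<open>The letter \<open>b - 1\<close> has key \<open>l\<close>, the least value
        that strands at or beyond \<open>l\<close> can reach through \<open>p\<close>; so moving
        \<open>a\<close> in front of it is a step down.\<close>
      from trace_ge[OF this] have tra: "l < trace p a" if "l \<le> a"
        using tr ne that by (metis le_neq_implies_less trace_eq_iff)
      consider "a < l" | "a = b" | "l \<le> a" "Suc a < b - 1 \<or> b < a" | "l \<le> a" "Suc a = b - 1"
        using ne by linarith
      then show ?thesis
      proof cases
        assume "a < l"
        moreover have "canon l \<rho>"
          using snoc canon.snoc[of j \<pi> l b l] by simp
        ultimately have "canon a (\<rho> @ [a..<Suc a])"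
          by (intro canon.snoc[of l]) auto
        then show ?thesis by auto
      next
        assume "a = b"
        then have "canon i (\<pi> @ [l..<Suc b])"
          using snoc by (intro canon.snoc[of j]) auto
        then show ?thesis using snoc \<open>a = b\<close> by auto
      next
        assume "l \<le> a" "Suc a < b - 1 \<or> b < a"
        then have "down (p @ [b - 1, a] @ []) (p @ [a, b - 1] @ [])"
          using tr tra snoc(4) by (intro down.commute) auto
        then show ?thesis using \<rho> by auto
      next
        assume a: "l \<le> a" "Suc a = b - 1"
        then have "\<rho> @ [a] = (\<pi> @ [l..<a]) @ [a, Suc a, a] @ []"
          unfolding \<rho> p_def a(2)[symmetric] by simp
        then show ?thesis
          using down.braid[of "\<pi> @ [l..<a]" a "[]"] by metis
      qed
    qed
  qed
qed (auto intro: canon.Nil)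

section \<open>Runs, and the agreement of \<open>canon\<close> with the definition of
  super-Yamanouchi words\<close>

lemma runs_eq_Nil_iff [simp]: "runs \<rho> = [] \<longleftrightarrow> \<rho> = []"
  by (induction \<rho> rule: runs.induct) auto

lemma concat_runs: "concat (runs \<rho>) = \<rho>"
proof (induction \<rho> rule: runs.induct)
  case (3 a b \<rho>)
  obtain r rs where "runs (b # \<rho>) = r # rs"
    by (cases "runs (b # \<rho>)") auto
  then show ?case using 3 by auto
qed auto

lemma runs_nonempty: "r \<in> set (runs \<rho>) \<Longrightarrow> r \<noteq> []"
proof (induction \<rho> rule: runs.induct)
  case (3 a b \<rho>)
  obtain r' rs where "runs (b # \<rho>) = r' # rs"
    by (cases "runs (b # \<rho>)") auto
  then show ?case using 3 by (auto split: if_splits)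
qed auto

lemma runs_append:
  "xs \<noteq> [] \<Longrightarrow> ys \<noteq> [] \<Longrightarrow> hd ys \<le> last xs \<Longrightarrow> runs (xs @ ys) = runs xs @ runs ys"
proof (induction xs rule: runs.induct)
  case (2 a)
  then show ?case by (cases ys) auto
next
  case (3 a b \<rho>)
  then show ?case by (cases "runs (b # \<rho>)") auto
qed auto

lemma runs_upt: "i < b \<Longrightarrow> runs [i..<b] = [[i..<b]]"
proof (induction "b - i" arbitrary: i)
  case (Suc d)
  show ?case
  proof (cases "Suc i < b")
    case True
    then have "runs [Suc i..<b] = [[Suc i..<b]]" using Suc by simp
    then show ?thesis using True Suc.prems by (simp add: upt_conv_Cons)
  next
    case False
    then have "b = Suc i" using Suc.prems by simp
    then show ?thesis by simp
  qed
qed simp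

lemma canon_super_yamanouchi:
  "canon i \<pi> \<Longrightarrow> super_yamanouchi \<pi> \<and> (\<forall>r \<in> set (runs \<pi>). i \<le> Min (set r))"
proof (induction rule: canon.induct)
  case (snoc j \<pi> i b h)
  have "runs (\<pi> @ [i..<b]) = runs \<pi> @ [[i..<b]]"
  proof (cases "\<pi> = []")
    case False
    then have "j \<le> last \<pi>" using canon_ge[OF snoc.hyps(1)] by simp
    then show ?thesis
      using runs_append[of \<pi> "[i..<b]"] False snoc.hyps runs_upt by auto
  qed (simp add: runs_upt snoc.hyps)
  moreover have "Min {i..<b} = i"
    using snoc.hyps by (intro Min_eqI) auto
  ultimately show ?case
    using snoc by (fastforce simp: super_yamanouchi_def sorted_wrt_append)
qed (simp add: super_yamanouchi_def)

lemma canon_concat: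
  assumes "\<forall>r \<in> set rs. r \<noteq> [] \<and> (\<exists>a b. r = [a..<b])"
    "sorted_wrt (>) (map (\<lambda>r. Min (set r)) rs)" "\<forall>r \<in> set rs. i \<le> Min (set r)"
  shows "canon i (concat rs)"
  using assms
proof (induction rs arbitrary: i rule: rev_induct)
  case (snoc r rs)
  then obtain a b where r: "r = [a..<b]" "a < b" by fastforce
  have "Min {a..<b} = a"
    using r by (intro Min_eqI) auto
  \<comment> \<open>The bound \<open>Suc a\<close> records that the earlier run minima strictly
    exceed \<open>a\<close>.\<close>
  then have "canon (Suc a) (concat rs)"
    using snoc r by (intro snoc.IH) (auto simp: sorted_wrt_append Suc_le_eq)
  then show ?case
    using canon.snoc[of "Suc a" "concat rs" a b i] snoc.prems r \<open>Min {a..<b} = a\<close> by simp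
qed (simp add: canon.Nil)

lemma super_yamanouchi_iff_canon: "super_yamanouchi \<rho> \<longleftrightarrow> (\<exists>i. canon i \<rho>)"
proof
  assume "super_yamanouchi \<rho>"
  then have "canon 0 (concat (runs \<rho>))"
    by (intro canon_concat) (auto simp: super_yamanouchi_def dest: runs_nonempty)
  then show "\<exists>i. canon i \<rho>" by (auto simp: concat_runs)
qed (use canon_super_yamanouchi in blast)

subsection \<open>The pairing\<close>

text \<open>The scan along the list of unpaired positions alone: \<open>map f qs\<close> is then the
  word of the remaining letters, to which keys and traces apply.\<close>

fun scan_list :: "(nat \<Rightarrow> nat) \<Rightarrow> nat \<Rightarrow> nat list \<Rightarrow> nat option" where
  "scan_list f k [] = None"
| "scan_list f k (q # qs) =
     (if f q = k then Some q
      else if f q + 1 = k then scan_list f (k - 1) qs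
      else scan_list f k qs)"

lemma scan_eq_scan_list:
  "scan \<rho> P k j = scan_list (letter \<rho>) k (filter (\<lambda>q. q \<notin> P) (rev [1..<Suc j]))"
  by (induction j arbitrary: k) auto

text \<open>
  The scan follows the strand that ends at position \<open>i\<close>, which sits at position \<open>k\<close>; as long as
  no letter matches, no strand ending to the right of \<open>i\<close> gets to the left of it.
\<close>

definition follows :: "nat list \<Rightarrow> nat \<Rightarrow> nat \<Rightarrow> bool" where
  "follows p i k \<longleftrightarrow> trace p k = i \<and> (\<forall>a<k. trace p a < i)"

text \<open>Only the letter \<open>k\<close> would move the strand to the right;
  \<open>k - 1\<close> moves it to the left, as the scan does with its value, and any other letter
  leaves it in place.\<close>

lemma follows_snoc:
  assumes "follows p i k" "c \<noteq> k"
  shows "follows (p @ [c]) i (if c + 1 = k then k - 1 else k)"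
proof -
  let ?k = "if c + 1 = k then k - 1 else k"
  have "transpose c (Suc c) ?k = k"
    using assms(2) by (auto simp: transpose_def)
  moreover have "transpose c (Suc c) a < k" if "a < ?k" for a
    using that assms(2) by (auto simp: transpose_def split: if_splits)
  ultimately show ?thesis using assms(1) by (simp add: follows_def)
qed

text \<open>A successful scan stops at the leftmost letter with key \<open>i\<close>:
  \<open>follows\<close> identifies its key, and the earlier letters have other keys. The prefix
  \<open>p\<close> holds the letters already scanned.\<close>

lemma scan_list_follows:
  assumes "follows p i k" "i \<notin> set (keys p)"
  shows "scan_list f k qs = None \<and> (\<exists>k'. follows (p @ map f qs) i k') \<or>
    (\<exists>q qs1 qs2. scan_list f k qs = Some q \<and> qs = qs1 @ q # qs2 \<and>
      follows (p @ map f qs1) i (f q) \<and> i \<notin> set (keys (p @ map f qs1)))"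
  using assms
proof (induction qs arbitrary: p k)
  case Nil
  then show ?case by auto
next
  case (Cons q qs)
  show ?case
  proof (cases "f q = k")
    case True
    then have "scan_list f k (q # qs) = Some q \<and> q # qs = [] @ q # qs \<and>
        follows (p @ map f []) i (f q) \<and> i \<notin> set (keys (p @ map f []))"
      using Cons.prems by simp
    then show ?thesis by blast
  next
    case False
    define k' where "k' = (if f q + 1 = k then k - 1 else k)"
    have scan: "scan_list f k (q # qs) = scan_list f k' qs"
      using False by (simp add: k'_def)
    have "follows (p @ [f q]) i k'"
      unfolding k'_def using Cons.prems(1) False by (rule follows_snoc)
    moreover have "i \<notin> set (keys (p @ [f q]))"
      using Cons.prems False by (auto simp: keys_append follows_def)
    ultimately consider k'' where "scan_list f k' qs = None" "follows ((p @ [f q]) @ map f qs) i k''"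
      | r qs1 qs2 where "scan_list f k' qs = Some r" "qs = qs1 @ r # qs2"
        "follows ((p @ [f q]) @ map f qs1) i (f r)" "i \<notin> set (keys ((p @ [f q]) @ map f qs1))"
      using Cons.IH[of "p @ [f q]" k'] by blast
    then show ?thesis
    proof cases
      case 1
      then show ?thesis unfolding scan by auto
    next
      case 2
      then have "scan_list f k' qs = Some r \<and> q # qs = (q # qs1) @ r # qs2 \<and>
          follows (p @ map f (q # qs1)) i (f r) \<and> i \<notin> set (keys (p @ map f (q # qs1)))"
        by simp
      then show ?thesis unfolding scan by blast
    qed
  qed
qed

text \<open>One step of the pairing: the crossing of the strands ending at \<open>i\<close> and
  \<open>Suc i\<close> is deleted. Its key \<open>i\<close> is maximal, so exactly the pairs with
  the letters before it are lost.\<close>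

lemma scan_list_last_descent:
  assumes red: "red (map f qs)"
    and mono: "strict_mono_on {i<..} (word_perm (map f qs))"
    and desc: "word_perm (map f qs) (Suc i) < word_perm (map f qs) i"
  obtains qs1 q qs2 where "scan_list f i qs = Some q" "qs = qs1 @ q # qs2"
    "word_perm (map f (qs1 @ qs2)) = word_perm (map f qs) \<circ> transpose i (Suc i)"
    "asc_pairs (keys (map f qs)) = length qs1 + asc_pairs (keys (map f (qs1 @ qs2)))"
proof -
  let ?w = "word_perm (map f qs)" and ?t = "transpose i (Suc i)"
  have "follows [] i i" by (simp add: follows_def)
  then consider k where "follows (map f qs) i k"
    | q qs1 qs2 where "scan_list f i qs = Some q" "qs = qs1 @ q # qs2"
      "follows (map f qs1) i (f q)" "i \<notin> set (keys (map f qs1))"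
    using scan_list_follows[of "[]" i i f qs] by auto
  then obtain q qs1 qs2 where q: "scan_list f i qs = Some q" "qs = qs1 @ q # qs2"
    "follows (map f qs1) i (f q)" "i \<notin> set (keys (map f qs1))"
  proof cases
    case 1
    \<comment> \<open>After a failed scan every value below \<open>k = ?w i\<close> would end to the
      left of \<open>i\<close>, although \<open>?w (Suc i)\<close> is such a value.\<close>
    then have k: "trace (map f qs) k = i" "\<forall>a<k. trace (map f qs) a < i"
      by (auto simp: follows_def)
    then have "?w i = k" by (metis word_perm_prefix_trace)
    then have "trace (map f qs) (?w (Suc i)) < i" using desc k by blast
    then show ?thesis by simp
  qed blast
  define p k s where "p = map f qs1" and "k = f q" and "s = map f qs2"
  have w: "map f qs = p @ k # s" and ps: "map f (qs1 @ qs2) = p @ s"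
    using q by (auto simp: p_def k_def s_def)
  have tr_k: "trace p k = i" and left: "\<And>a. a < k \<Longrightarrow> trace p a < i"
    and notin: "i \<notin> set (keys p)"
    using q by (auto simp: p_def k_def follows_def)
  \<comment> \<open>Otherwise the strand ending at \<open>Suc i\<close> lies to the right of
    \<open>Suc k\<close> and crosses that strand within \<open>p\<close>; this gives an inversion
    beyond the last descent.\<close>
  have tr_Suc: "trace p (Suc k) = Suc i"
  proof (rule ccontr)
    assume ne: "trace p (Suc k) \<noteq> Suc i"
    define a where "a = word_perm p (Suc i)"
    have tr_a: "trace p a = Suc i" by (simp add: a_def)
    have "i < trace p (Suc k)"
      using trace_descent_less[of p k s] red w tr_k by simp
    with ne have gt: "Suc i < trace p (Suc k)" by simp
    have "k \<le> a" using left[of a] tr_a by (cases "a < k") auto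
    moreover have "a \<noteq> k" "a \<noteq> Suc k" using tr_a tr_k ne by auto
    ultimately have "Suc k < a" by simp
    then have "word_perm (k # s) (Suc k) < word_perm (k # s) a"
      using red_noncrossing[of p "k # s" "Suc k" a] red w tr_a gt by simp
    then have "?w (trace p (Suc k)) < ?w (Suc i)"
      unfolding w by (metis tr_a word_perm_trace)
    moreover have "?w (Suc i) < ?w (trace p (Suc k))"
      using gt by (intro strict_mono_onD[OF mono]) auto
    ultimately show False by simp
  qed
  have "word_perm (p @ s) x = ?w (?t x)" for x
  proof -
    have "x = trace p (word_perm p x)" by simp
    then have "?t x = trace p (transpose k (Suc k) (word_perm p x))"
      using trace_transpose[of p k "Suc k"] tr_k tr_Suc by simp
    then show ?thesis
      unfolding w by (simp only: word_perm_trace) (simp add: word_perm_append)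
  qed
  then have perm: "word_perm (map f (qs1 @ qs2)) = ?w \<circ> ?t"
    unfolding ps by (simp add: fun_eq_iff)
  define ks where "ks = map (trace p) (keys s)"
  have K: "keys (map f qs) = keys p @ i # map ?t ks"
    unfolding w by (simp add: keys_append ks_def tr_k tr_Suc trace_transpose)
  have K': "keys (p @ s) = keys p @ ks"
    by (simp add: keys_append ks_def)
  have le: "x \<le> i" if "x \<in> set (keys (map f qs))" for x
    using keys_le_last_descent[OF red mono that] .
  have less: "x < i" if "x \<in> set (keys p)" for x
    using le[of x] that notin K by (cases "x = i") auto
  \<comment> \<open>The key \<open>i\<close> cannot occur in \<open>ks\<close>: \<open>?t\<close>
    would send it to \<open>Suc i\<close>, above the bound.\<close>
  have ks_cases: "x < i \<or> x = Suc i" if "x \<in> set ks" for x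
  proof -
    have "?t x \<in> set (keys (map f qs))" using that K by simp
    then show ?thesis using le by (fastforce simp: transpose_def split: if_splits)
  qed
  \<comment> \<open>On these keys \<open>?t\<close> merely renames \<open>Suc i\<close> to
    \<open>i\<close>, so the relative order is kept.\<close>
  have "strict_mono_on (set (keys p @ ks)) ?t"
  proof (rule strict_mono_onI)
    fix x y assume "x \<in> set (keys p @ ks)" "y \<in> set (keys p @ ks)" "x < y"
    then have "x < i \<or> x = Suc i" "y < i \<or> y = Suc i"
      using less[of x] less[of y] ks_cases[of x] ks_cases[of y] by auto
    then show "?t x < ?t y" using \<open>x < y\<close> by (auto simp: transpose_def)
  qed
  then have "asc_pairs (keys p @ ks) = asc_pairs (map ?t (keys p @ ks))"
    by (simp only: asc_pairs_map)
  also have "map ?t (keys p) = keys p"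
    using less by (intro map_idI) (force simp: transpose_def)
  then have "map ?t (keys p @ ks) = keys p @ map ?t ks" by simp
  finally have "asc_pairs (keys p @ ks) = asc_pairs (keys p @ map ?t ks)" .
  moreover have "filter (\<lambda>y. i < y) (map ?t ks) = []"
    using le K by (auto simp: filter_empty_conv not_less)
  moreover have "(\<Sum>x\<leftarrow>keys p. length (filter (\<lambda>y. x < y) (i # map ?t ks))) =
      (\<Sum>x\<leftarrow>keys p. 1 + length (filter (\<lambda>y. x < y) (map ?t ks)))"
    using less by (intro arg_cong[of _ _ sum_list] map_cong) auto
  moreover have "length (keys p) = length qs1" by (simp add: p_def)
  ultimately have "asc_pairs (keys (map f qs)) = length qs1 + asc_pairs (keys (map f (qs1 @ qs2)))"
    unfolding K K' ps asc_pairs_append by (simp add: sum_list_Suc asc_pairs_append)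
  then show ?thesis using that q perm by blast
qed

lemma reduced_words_Cons_descent:
  assumes "i # \<tau> \<in> reduced_words n u"
  shows "1 \<le> i" "i < n" "u (Suc i) < u i" "\<tau> \<in> reduced_words n (u \<circ> transpose i (Suc i))"
  using assms red_descent[of i \<tau>]
  by (auto simp: reduced_words_iff word_perm_Cons comp_assoc)

text \<open>Induction over the steps still to be done: \<tau> is the rest of \<pi>,
  \<open>qs\<close> the unpaired positions from left to right, and \<open>vs\<close> lists the
  positions to be assigned, in order of assignment.\<close>

lemma pair_from_asc_pairs:
  assumes "\<pi> = \<pi>0 @ \<tau>" "canon h \<tau>" "\<tau> \<in> reduced_words n u"
    and "qs = filter (\<lambda>q. q \<notin> ran v) (rev [1..<Suc (length \<rho>)])"
    and "map (letter \<rho>) qs \<in> reduced_words n u" "\<forall>j\<le>length \<tau>. v j = None"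
  shows "\<exists>vs. length vs = length \<tau> \<and> mset vs = mset qs \<and>
    asc_pairs vs = asc_pairs (keys (map (letter \<rho>) qs)) \<and>
    pair_from \<pi> \<rho> v (length \<tau>) =
      (\<lambda>j. if 1 \<le> j \<and> j \<le> length \<tau> then Some (letter vs j) else v j)"
  using assms
proof (induction \<tau> arbitrary: \<pi>0 v qs u rule: list.induct)
  case Nil
  have "length (map (letter \<rho>) qs) = length ([] :: nat list)"
    using Nil.prems(3,5) unfolding reduced_words_def mem_Collect_eq by linarith
  then have "qs = []" by simp
  then show ?case by auto
next
  case (Cons i \<tau>)
  let ?f = "letter \<rho>" and ?m = "Suc (length \<tau>)"
  note i = reduced_words_Cons_descent[OF Cons.prems(3)]
  have u: "u = word_perm (map ?f qs)" "u = word_perm (i # \<tau>)" "red (map ?f qs)"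
    using Cons.prems(3,5) unfolding reduced_words_iff by blast+
  obtain qs1 q qs2 where q: "scan_list ?f i qs = Some q" "qs = qs1 @ q # qs2"
    "word_perm (map ?f (qs1 @ qs2)) = u \<circ> transpose i (Suc i)"
    "asc_pairs (keys (map ?f qs)) = length qs1 + asc_pairs (keys (map ?f (qs1 @ qs2)))"
    using scan_list_last_descent[of ?f qs i] canon_strict_mono[OF Cons.prems(2)] u i(3) by metis
  have sorted: "sorted_wrt (>) qs"
    unfolding Cons.prems(4) by (intro sorted_wrt_filter) (simp add: sorted_wrt_rev del: upt_Suc)
  have gt: "\<forall>x \<in> set qs1. q < x" and lt: "\<forall>x \<in> set qs2. x < q"
    using sorted q(2) by (auto simp: sorted_wrt_append)
  have "letter \<pi> ?m = i"
    using Cons.prems(1) by (simp add: letter_def nth_append)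
  then have scan: "scan \<rho> (ran v) (letter \<pi> ?m) (length \<rho>) = Some q"
    using q(1) Cons.prems(4) scan_eq_scan_list by metis
  define v' where "v' = v(?m := Some q)"
  have "ran v' = insert q (ran v)"
    using Cons.prems(6) by (simp add: v'_def)
  then have "filter (\<lambda>x. x \<notin> ran v') (rev [1..<Suc (length \<rho>)]) = filter (\<lambda>x. x \<noteq> q) qs"
    unfolding Cons.prems(4) filter_filter by (intro filter_cong) auto
  also have "filter (\<lambda>x. x \<noteq> q) qs1 = qs1" "filter (\<lambda>x. x \<noteq> q) qs2 = qs2"
    using gt lt by (auto simp: filter_id_conv)
  then have "filter (\<lambda>x. x \<noteq> q) qs = qs1 @ qs2" using q(2) by simp
  finally have qs': "qs1 @ qs2 = filter (\<lambda>x. x \<notin> ran v') (rev [1..<Suc (length \<rho>)])" by simp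
  \<comment> \<open>The length drops by one together with the number of letters, so the shortened
    word is again reduced.\<close>
  have "Suc (perm_length n (u \<circ> transpose i (Suc i))) = perm_length n u"
    using i by (intro perm_length_transpose_descent)
  then have red': "map ?f (qs1 @ qs2) \<in> reduced_words n (u \<circ> transpose i (Suc i))"
    using Cons.prems(5) q(2,3) by (auto simp: reduced_words_def)
  have "\<forall>j\<le>length \<tau>. v' j = None"
    using Cons.prems(6) by (simp add: v'_def)
  moreover have "\<pi> = (\<pi>0 @ [i]) @ \<tau>" using Cons.prems(1) by simp
  ultimately obtain vs where vs: "length vs = length \<tau>" "mset vs = mset (qs1 @ qs2)"
    "asc_pairs vs = asc_pairs (keys (map ?f (qs1 @ qs2)))"
    "pair_from \<pi> \<rho> v' (length \<tau>) =
      (\<lambda>j. if 1 \<le> j \<and> j \<le> length \<tau> then Some (letter vs j) else v' j)"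
    using Cons.IH[OF _ canon_ConsD[OF Cons.prems(2)] i(4) qs' red'] by blast
  \<comment> \<open>The positions assigned later that exceed \<open>q\<close> are those of
    \<open>qs1\<close>, as many as the pairs of keys lost with \<open>q\<close>.\<close>
  have "length (filter (\<lambda>y. q < y) vs) = length (filter (\<lambda>y. q < y) (qs1 @ qs2))"
    using vs(2) by (metis mset_filter size_mset)
  also have "\<dots> = length qs1"
    using gt lt by (auto simp: filter_id_conv[THEN iffD2] filter_empty_conv)
  finally have "asc_pairs (q # vs) = asc_pairs (keys (map ?f qs))"
    using vs(3) q(4) by simp
  moreover have "mset (q # vs) = mset qs" using vs(2) q(2) by simp
  moreover have "pair_from \<pi> \<rho> v ?m =
      (\<lambda>j. if 1 \<le> j \<and> j \<le> ?m then Some (letter (q # vs) j) else v j)"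
    using scan vs(1,4) by (auto simp: fun_eq_iff v'_def letter_def Suc_diff_le)
  ultimately show ?case using vs(1) by (intro exI[of _ "q # vs"]) simp
qed

section \<open>Inversions and letter sums in the right-to-left numbering\<close>

lemma card_inversions_letter:
  "card {(i, j). 1 \<le> i \<and> i < j \<and> j \<le> length vs \<and> letter vs i > letter vs j} = asc_pairs vs"
proof (induction vs)
  case (Cons x vs)
  let ?l = "length vs"
  let ?A = "{(i, j). 1 \<le> i \<and> i < j \<and> j \<le> ?l \<and> letter vs i > letter vs j}"
  let ?B = "{i. 1 \<le> i \<and> i \<le> ?l \<and> x < letter vs i}"
  have letter: "letter (x # vs) i = letter vs i" if "i \<le> ?l" for i
    using that by (simp add: letter_def Suc_diff_le)
  have letter_x: "letter (x # vs) (Suc ?l) = x" by (simp add: letter_def)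
  \<comment> \<open>The head has the largest index, so it is the second member of each new
    inversion.\<close>
  have "{(i, j). 1 \<le> i \<and> i < j \<and> j \<le> length (x # vs) \<and> letter (x # vs) i > letter (x # vs) j} =
      ?A \<union> (\<lambda>i. (i, Suc ?l)) ` ?B"
    by (auto simp: le_Suc_eq letter letter_x)
  moreover have "finite ?A"
    by (rule finite_subset[of _ "{..?l} \<times> {..?l}"]) auto
  moreover have "finite ?B"
    by (rule finite_subset[of _ "{..?l}"]) auto
  moreover have "card ((\<lambda>i. (i, Suc ?l)) ` ?B) = card ?B"
    by (intro card_image) (auto simp: inj_on_def)
  moreover have "card ?B = card {i. i < ?l \<and> x < vs ! i}"
    by (rule bij_betw_same_card[of "\<lambda>i. ?l - i"], rule bij_betw_byWitness[of _ "\<lambda>i. ?l - i"])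
      (auto simp: letter_def)
  moreover have "?A \<inter> (\<lambda>i. (i, Suc ?l)) ` ?B = {}" by auto
  ultimately show ?case
    using Cons.IH by (simp add: card_Un_disjoint length_filter_conv_card)
next
  case Nil
  have "{(i, j). 1 \<le> i \<and> i < j \<and> j \<le> length ([] :: nat list) \<and> letter [] i > letter [] j} = {}" by auto
  then show ?case by (simp only: card.empty asc_pairs.simps)
qed

lemma sum_letter: "(\<Sum>i = 1..length \<rho>. int (letter \<rho> i)) = int (sum_list \<rho>)"
proof -
  have "(\<Sum>i = 1..length \<rho>. int (letter \<rho> i)) = (\<Sum>i = 0..<length \<rho>. int (\<rho> ! i))"
    by (rule sum.reindex_bij_witness[of _ "\<lambda>i. length \<rho> - i" "\<lambda>i. length \<rho> - i"])
      (auto simp: letter_def)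
  then show ?thesis by (simp add: sum_list_sum_nth)
qed

subsection \<open>Coxeter moves\<close>

text \<open>Letters are counted from the right: \<open>s\<close> holds the positions up to
  \<open>length s\<close>, and \<open>d\<close> is the next one.\<close>

lemma commutation_move_append:
  "commutation_move (Suc (length s)) (p @ [c, d] @ s) =
    (if Suc c < d \<or> Suc d < c then p @ [d, c] @ s else p @ [c, d] @ s)"
  by (auto simp: commutation_move_def letter_def set_letter_def nth_append list_update_append
    Suc_diff_le)

lemma yang_baxter_move_append:
  "yang_baxter_move (Suc (Suc (length s))) (p @ [a, b, c] @ s) =
    (if c = a \<and> (b = Suc a \<or> a = Suc b) then p @ [b, a, b] @ s else p @ [a, b, c] @ s)"
  by (auto simp: yang_baxter_move_def letter_def set_letter_def nth_append list_update_append
    Suc_diff_le Let_def)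

lemma split_block:
  assumes "j + k \<le> length \<rho>"
  obtains p xs s where "\<rho> = p @ xs @ s" "length xs = k" "length s = j"
proof
  define m where "m = length \<rho> - j - k"
  show "\<rho> = take m \<rho> @ take k (drop m \<rho>) @ drop k (drop m \<rho>)"
    by (simp only: append_take_drop_id)
  show "length (take k (drop m \<rho>)) = k" "length (drop k (drop m \<rho>)) = j"
    using assms by (auto simp: m_def)
qed

lemma coxeter_move_down:
  assumes "f \<in> coxeter_moves (length \<rho>)"
  shows "f \<rho> = \<rho> \<or> down \<rho> (f \<rho>) \<or> down (f \<rho>) \<rho>"
proof -
  consider j where "f = commutation_move (Suc j)" "j + 2 \<le> length \<rho>"
    | j where "f = yang_baxter_move (Suc (Suc j))" "j + 3 \<le> length \<rho>"
  proof -
    consider i where "f = commutation_move i" "1 \<le> i" "i < length \<rho>"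
      | i where "f = yang_baxter_move i" "1 < i" "i < length \<rho>"
      using assms by (auto simp: coxeter_moves_def)
    then show ?thesis
    proof cases
      case (1 i)
      then show ?thesis using that(1)[of "i - 1"] by simp
    next
      case (2 i)
      moreover from this have "Suc (Suc (i - 2)) = i" by simp
      ultimately show ?thesis using that(2)[of "i - 2"] by simp
    qed
  qed
  then show ?thesis
  proof cases
    case 1
    then obtain p xs s where "\<rho> = p @ xs @ s" "length xs = 2" "length s = j"
      using split_block by metis
    then obtain c d where \<rho>: "\<rho> = p @ [c, d] @ s"
      by (auto simp: numeral_2_eq_2 length_Suc_conv)
    have f: "f \<rho> = (if Suc c < d \<or> Suc d < c then p @ [d, c] @ s else \<rho>)"
      using 1 \<rho> \<open>length s = j\<close> commutation_move_append by metis
    show ?thesis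
    proof (cases "Suc c < d \<or> Suc d < c")
      case True
      \<comment> \<open>Distinct letters have distinct keys here, so the move is a step down in
        exactly one direction.\<close>
      then have "trace p c \<noteq> trace p d" by auto
      then consider "trace p c < trace p d" | "trace p d < trace p c" by linarith
      then show ?thesis
        using down.commute[of c d p s] down.commute[of d c p s] True f \<rho> by cases auto
    qed (use f in simp)
  next
    case 2
    then obtain p xs s where "\<rho> = p @ xs @ s" "length xs = 3" "length s = j"
      using split_block by metis
    then obtain a b c where \<rho>: "\<rho> = p @ [a, b, c] @ s"
      by (auto simp: numeral_3_eq_3 length_Suc_conv)
    have f: "f \<rho> = (if c = a \<and> (b = Suc a \<or> a = Suc b) then p @ [b, a, b] @ s else \<rho>)"
      using 2 \<rho> \<open>length s = j\<close> yang_baxter_move_append by metis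
    show ?thesis
      using down.braid[of p a s] down.braid[of p b s] f \<rho> by auto
  qed
qed

lemma down_coxeter_move:
  assumes "down \<rho> \<rho>'"
  obtains f where "f \<in> coxeter_moves (length \<rho>)" "f \<rho> = \<rho>'"
  using assms
proof cases
  case (commute c d p s)
  then have "commutation_move (Suc (length s)) \<rho> = \<rho>'"
    using commutation_move_append[of s p c d] by auto
  moreover have "commutation_move (Suc (length s)) \<in> coxeter_moves (length \<rho>)"
    using commute by (force simp: coxeter_moves_def)
  ultimately show ?thesis using that by blast
next
  case (braid p a s)
  then have "yang_baxter_move (Suc (Suc (length s))) \<rho> = \<rho>'"
    using yang_baxter_move_append[of s p a "Suc a" a] by auto
  moreover have "yang_baxter_move (Suc (Suc (length s))) \<in> coxeter_moves (length \<rho>)"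
    using braid by (force simp: coxeter_moves_def)
  ultimately show ?thesis using that by blast
qed

text \<open>For the lower bound: no move, trivial ones included, lowers the rank by more than
  one.\<close>

lemma coxeter_move_rank:
  assumes "f \<in> coxeter_moves (perm_length n w)" "\<rho> \<in> reduced_words n w"
  shows "f \<rho> \<in> reduced_words n w" "rank \<rho> \<le> Suc (rank (f \<rho>))"
proof -
  have "f \<rho> = \<rho> \<or> down \<rho> (f \<rho>) \<or> down (f \<rho>) \<rho>"
    using assms by (intro coxeter_move_down) (auto simp: reduced_words_def)
  moreover from this show "f \<rho> \<in> reduced_words n w"
    using assms(2) down_reduced_words by metis
  ultimately show "rank \<rho> \<le> Suc (rank (f \<rho>))"
    using assms(2) down_rank[of \<rho> "f \<rho>"] down_rank[of "f \<rho>" \<rho>]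
    by (auto simp: reduced_words_iff)
qed

lemma apply_moves_rank:
  assumes "set gs \<subseteq> coxeter_moves (perm_length n w)" "\<rho> \<in> reduced_words n w"
  shows "apply_moves gs \<rho> \<in> reduced_words n w \<and> rank \<rho> \<le> length gs + rank (apply_moves gs \<rho>)"
  using assms
proof (induction gs)
  case Nil
  then show ?case by (simp add: apply_moves_def)
next
  case (Cons g gs)
  then show ?case
    using coxeter_move_rank[of g n w "apply_moves gs \<rho>"] by (force simp: apply_moves_def)
qed

text \<open>Step down as long as possible: each step costs one unit of rank, and a word with no step
  down is super-Yamanouchi.\<close>

lemma exists_moves_to_super_yamanouchi:
  assumes "\<rho> \<in> reduced_words n w"
  shows "\<exists>fs. set fs \<subseteq> coxeter_moves (perm_length n w) \<and> super_yamanouchi (apply_moves fs \<rho>) \<and>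
    rank \<rho> = length fs + rank (apply_moves fs \<rho>)"
  using assms
proof (induction "rank \<rho>" arbitrary: \<rho>)
  case 0
  then have red: "red \<rho>" by (simp add: reduced_words_iff)
  then have "super_yamanouchi \<rho>"
    using down_or_canon[OF red_imp_distinct_adj[OF red]] down_rank[OF _ red] 0
    by (auto simp: super_yamanouchi_iff_canon)
  then show ?case by (intro exI[of _ "[]"]) (simp add: apply_moves_def)
next
  case (Suc r)
  then have red: "red \<rho>" by (simp add: reduced_words_iff)
  then consider "super_yamanouchi \<rho>" | \<rho>' where "down \<rho> \<rho>'"
    using down_or_canon[OF red_imp_distinct_adj[OF red]] super_yamanouchi_iff_canon by blast
  then show ?case
  proof cases
    case 1
    then show ?thesis by (intro exI[of _ "[]"]) (simp add: apply_moves_def)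
  next
    case 2
    have rank: "rank \<rho> = Suc (rank \<rho>')" by (rule down_rank[OF 2 red])
    have "\<rho>' \<in> reduced_words n w" using Suc.prems down_reduced_words[OF 2] by blast
    then obtain fs where fs: "set fs \<subseteq> coxeter_moves (perm_length n w)"
      "super_yamanouchi (apply_moves fs \<rho>')" "rank \<rho>' = length fs + rank (apply_moves fs \<rho>')"
      using Suc.hyps(1)[of \<rho>'] Suc.hyps(2) rank by auto
    obtain f where "f \<in> coxeter_moves (perm_length n w)" "f \<rho> = \<rho>'"
      using down_coxeter_move[OF 2] Suc.prems by (auto simp: reduced_words_def)
    then show ?thesis
      \<comment> \<open>The move applied first stands last in the list.\<close>
      using fs rank by (intro exI[of _ "fs @ [f]"]) (simp add: apply_moves_def)
  qed
qed

lemma super_yamanouchi_unique: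
  assumes "\<pi> \<in> reduced_words n w" "super_yamanouchi \<pi>"
    and "\<pi>' \<in> reduced_words n w" "super_yamanouchi \<pi>'"
  shows "\<pi> = \<pi>'"
proof -
  obtain i j where "canon i \<pi>" "canon j \<pi>'"
    using assms(2,4) by (auto simp: super_yamanouchi_iff_canon)
  then show ?thesis
    by (rule canon_unique) (use assms in \<open>auto simp: reduced_words_iff\<close>)
qed

theorem theorem2p13:
  fixes n :: nat and w :: "nat \<Rightarrow> nat" and \<rho> :: "nat list"
  assumes "w permutes {1..n}" and "\<rho> \<in> reduced_words n w"
  shows "(\<exists>!\<pi>. \<pi> \<in> reduced_words n w \<and> super_yamanouchi \<pi>) \<and>
    dom (pairing n w \<rho>) = {1..perm_length n w} \<and>
    perm_word n w \<rho> permutes {1..perm_length n w} \<and>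
    inv_word n w \<rho> \<ge> 0 \<and>
    (\<exists>fs. set fs \<subseteq> coxeter_moves (perm_length n w) \<and> int (length fs) = inv_word n w \<rho> \<and>
      super_yamanouchi (apply_moves fs \<rho>)) \<and>
    (\<forall>gs. set gs \<subseteq> coxeter_moves (perm_length n w) \<and> super_yamanouchi (apply_moves gs \<rho>) \<longrightarrow>
      int (length gs) \<ge> inv_word n w \<rho>)"
proof -
  let ?l = "perm_length n w"
  obtain fs where fs: "set fs \<subseteq> coxeter_moves ?l" "super_yamanouchi (apply_moves fs \<rho>)"
    "rank \<rho> = length fs + rank (apply_moves fs \<rho>)"
    using exists_moves_to_super_yamanouchi[OF assms(2)] by blast
  \<comment> \<open>The end of the descent itself provides the super-Yamanouchi word.\<close>
  define \<pi> where "\<pi> = apply_moves fs \<rho>"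
  have \<pi>: "\<pi> \<in> reduced_words n w" "super_yamanouchi \<pi>"
    using apply_moves_rank[OF fs(1) assms(2)] fs(2) by (auto simp: \<pi>_def)
  have unique: "\<sigma> = \<pi>" if "\<sigma> \<in> reduced_words n w" "super_yamanouchi \<sigma>" for \<sigma>
    using super_yamanouchi_unique that \<pi> by blast
  have word: "super_yamanouchi_word n w = \<pi>"
    unfolding super_yamanouchi_word_def using \<pi> unique by (intro the_equality) blast+
  obtain h where canon: "canon h \<pi>"
    using \<pi>(2) by (auto simp: super_yamanouchi_iff_canon)
  have len: "length \<rho> = ?l" "length \<pi> = ?l"
    using assms(2) \<pi>(1) unfolding reduced_words_def by blast+
  define qs where "qs = rev [1..<Suc (length \<rho>)]"
  have "map (letter \<rho>) qs = \<rho>"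
    by (rule nth_equalityI) (auto simp: qs_def letter_def rev_nth simp del: upt_Suc)
  then obtain vs where vs: "length vs = ?l" "mset vs = mset qs"
    "asc_pairs vs = asc_pairs (keys \<rho>)"
    "pairing n w \<rho> = (\<lambda>j. if 1 \<le> j \<and> j \<le> ?l then Some (letter vs j) else None)"
    using pair_from_asc_pairs[of \<pi> "[]" \<pi> h n w qs Map.empty \<rho>] canon \<pi>(1) assms(2) len
    by (auto simp: pairing_def word qs_def simp del: upt_Suc)
  have dom: "dom (pairing n w \<rho>) = {1..?l}"
    by (auto simp: vs(4) dom_def)
  have perm_word: "perm_word n w \<rho> j = (if 1 \<le> j \<and> j \<le> ?l then letter vs j else j)" for j
    by (simp add: perm_word_def vs(4))
  have "distinct vs"
    using mset_eq_imp_distinct_iff[OF vs(2)] by (simp add: qs_def del: upt_Suc)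
  have "set vs = {1..?l}"
    using mset_eq_setD[OF vs(2)] len by (simp add: qs_def atLeastLessThanSuc_atLeastAtMost del: upt_Suc)
  have "bij_betw (\<lambda>j. ?l - j) {1..?l} {..<?l}"
    by (rule bij_betw_byWitness[of _ "\<lambda>j. ?l - j"]) auto
  moreover have "bij_betw ((!) vs) {..<?l} {1..?l}"
    using bij_betw_nth[OF \<open>distinct vs\<close>] vs(1) \<open>set vs = {1..?l}\<close> by auto
  ultimately have "bij_betw ((!) vs \<circ> (\<lambda>j. ?l - j)) {1..?l} {1..?l}"
    by (rule bij_betw_trans)
  then have "bij_betw (perm_word n w \<rho>) {1..?l} {1..?l}"
    by (rule bij_betw_cong[THEN iffD1, rotated]) (auto simp: perm_word letter_def vs(1))
  then have permutes: "perm_word n w \<rho> permutes {1..?l}"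
    by (rule bij_imp_permutes) (auto simp: perm_word)
  have "perm_length ?l (perm_word n w \<rho>) =
      card {(i, j). 1 \<le> i \<and> i < j \<and> j \<le> length vs \<and> letter vs i > letter vs j}"
    unfolding perm_length_def[of ?l] vs(1) by (intro arg_cong[of _ _ card]) (auto simp: perm_word)
  then have "perm_length ?l (perm_word n w \<rho>) = asc_pairs (keys \<rho>)"
    by (simp only: card_inversions_letter vs(3))
  \<comment> \<open>Thus the rank of \<pi> is its letter sum, and the formula for
    \<open>inv_word\<close> becomes a difference of ranks.\<close>
  moreover have "asc_pairs (keys \<pi>) = 0"
    using canon_keys[OF canon] asc_pairs_sorted by blast
  ultimately have inv: "inv_word n w \<rho> = int (rank \<rho>) - int (rank \<pi>)"
    using sum_letter[of \<rho>] sum_letter[of \<pi>] len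
    by (simp add: inv_word_def word rank_def sum_subtractf)
  have inv_fs: "int (length fs) = inv_word n w \<rho>"
    using fs(3) by (simp add: inv \<pi>_def)
  \<comment> \<open>By uniqueness \<open>gs\<close> also ends at \<pi>, so it has to bridge the same
    difference of ranks.\<close>
  have "inv_word n w \<rho> \<le> int (length gs)"
    if "set gs \<subseteq> coxeter_moves ?l" "super_yamanouchi (apply_moves gs \<rho>)" for gs
    using apply_moves_rank[OF that(1) assms(2)] unique[OF _ that(2)] inv by auto
  then show ?thesis
    using \<pi> unique dom permutes fs(1,2) inv_fs by (metis of_nat_0_le_iff)
qed

end
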